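(* Let $k$ be a finite field of characteristic different from $2$ and $3$, containing a primitive third root of unity $\omega$. Let $\mathfrak C$ be the split octonion algebra over $k$ in its matrix model and $L$ its diagonal subalgebra. Let $$A=\begin{pmatrix} \omega & -1 & 0 \\ 0 & \omega & 1 \\ 0 & 0 & \omega \end{pmatrix}\in SL(3,k),$$ let $b\in k$ be such that $X^3-b^2$ is irreducible over $k$, let $D=\mathrm{diag}(b,1,1)$ and $B=DAD^{-1}\in SL(3,k)$. Let $t\in\mathrm{Aut}(\mathfrak C)$ be the automorphism fixing $L$ pointwise that corresponds to $B$, i.e. $$t\begin{pmatrix} \alpha & v \\ w & \beta \end{pmatrix}=\begin{pmatrix} \alpha & Bv \\ {}^tB^{-1}w & \beta \end{pmatrix}.$$ Then $t$ is not real, i.e. $t$ is not conjugate to $t^{-1}$ in $\mathrm{Aut}(\mathfrak C)$.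
   Context: Matrix model of the split octonion algebra: $\mathfrak C=\left\{\begin{pmatrix} \alpha & v \\ w & \beta \end{pmatrix}:\alpha,\beta\in k,\ v,w\in k^3\right\}$ with entrywise addition and multiplication $$\begin{pmatrix} \alpha & v \\ w & \beta \end{pmatrix}\begin{pmatrix} \alpha' & v' \\ w' & \beta' \end{pmatrix}=\begin{pmatrix} \alpha\alpha'-\langle v,w'\rangle & \alpha v'+\beta'v+w\wedge w' \\ \beta w'+\alpha'w+v\wedge v' & \beta\beta'-\langle w,v'\rangle \end{pmatrix},$$ where $\langle v,w\rangle=\sum_i v_iw_i$ and $\langle u\wedge v,w\rangle=\det(u,v,w)$. The norm is $N=\alpha\beta+\langle v,w\rangle$. The diagonal subalgebra is $L=\{v=w=0\}\cong k\times k$. For every $B\in SL(3,k)$ the displayed formula for $t$ defines a $k$-algebra automorphism of $\mathfrak C$ fixing $L$ pointwise, and all such automorphisms arise this way. $\mathrm{Aut}(\mathfrak C)$ denotes the group of $k$-algebra automorphisms. *)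

theory Defs
  imports
    "HOL-Analysis.Analysis"
    "HOL-Computational_Algebra.Polynomial"
    "HOL-Algebra.Group"
begin

section \<open>The cross product over an arbitrary field\<close>

text \<open>The library's \<open>cross3\<close> exists over the reals only.  The explicit formula is
  determined by \<open>\<langle>u \<and> v, w\<rangle> = det (u, v, w)\<close>; see \<open>wedge_det\<close> and \<open>wedge_unique\<close>.\<close>

definition wedge :: "'a::field ^ 3 \<Rightarrow> 'a ^ 3 \<Rightarrow> 'a ^ 3" where
  "wedge u v = vector [u $ 2 * v $ 3 - u $ 3 * v $ 2,
                       u $ 3 * v $ 1 - u $ 1 * v $ 3,
                       u $ 1 * v $ 2 - u $ 2 * v $ 1]"

lemma wedge_det: "scalar_product (wedge u v) w = det (vector [u, v, w] :: 'a::field ^ 3 ^ 3)"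
  by (simp add: scalar_product_def wedge_def det_3 sum_3 algebra_simps)

lemma scalar_product_eqI:
  fixes x y :: "'a::field ^ 3"
  assumes "\<And>w. scalar_product x w = scalar_product y w"
  shows "x = y"
proof -
  have "x $ i = y $ i" for i
    using assms[of "axis i 1"] by (simp add: scalar_product_def axis_def if_distrib cong: if_cong)
  then show ?thesis by (simp add: vec_eq_iff)
qed

lemma wedge_unique:
  assumes "\<And>w. scalar_product x w = det (vector [u, v, w] :: 'a::field ^ 3 ^ 3)"
  shows "x = wedge u v"
  by (rule scalar_product_eqI) (simp add: assms wedge_det)

lemma scalar_product_transpose:
  fixes M :: "'a::field ^ 3 ^ 3"
  shows "scalar_product (transpose M *v x) y = scalar_product x (M *v y)"
  by (simp add: scalar_product_def matrix_vector_mult_def transpose_def sum_3 algebra_simps)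

lemma wedge_matrix:
  fixes M N :: "'a::field ^ 3 ^ 3"
  assumes "M ** N = mat 1" and "det M = 1"
  shows "wedge (M *v u) (M *v v) = transpose N *v wedge u v"
proof (rule scalar_product_eqI)
  fix w
  have w: "w = M *v (N *v w)"
    by (simp add: matrix_vector_mul_assoc assms)
  have "(vector [M *v u, M *v v, M *v z] :: 'a ^ 3 ^ 3) $ i $ j
      = ((vector [u, v, z] :: 'a ^ 3 ^ 3) ** transpose M) $ i $ j" for z i j
    using exhaust_3[of i]
    by (auto simp: matrix_matrix_mult_def matrix_vector_mult_def transpose_def mult.commute)
  then have "(vector [M *v u, M *v v, M *v (N *v w)] :: 'a ^ 3 ^ 3)
      = (vector [u, v, N *v w] :: 'a ^ 3 ^ 3) ** transpose M"
    by (simp only: vec_eq_iff) blast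
  then have "det (vector [M *v u, M *v v, w] :: 'a ^ 3 ^ 3)
      = det (vector [u, v, N *v w] :: 'a ^ 3 ^ 3)"
    using w assms by (metis det_mul det_transpose mult.right_neutral)
  then show "scalar_product (wedge (M *v u) (M *v v)) w
      = scalar_product (transpose N *v wedge u v) w"
    by (simp add: scalar_product_transpose wedge_det del: transpose_matrix_vector)
qed


section \<open>The split octonion algebra in its matrix model\<close>

text \<open>\<open>Oct \<alpha> v w \<beta>\<close> is the matrix with first row \<open>\<alpha>, v\<close> and second row \<open>w, \<beta>\<close>.\<close>

datatype 'a split_octonion = Oct 'a "'a ^ 3" "'a ^ 3" 'a

instantiation split_octonion :: (field) ab_group_add
begin

definition "0 = Oct 0 0 0 0"

fun plus_split_octonion where
  "Oct \<alpha> v w \<beta> + Oct \<alpha>' v' w' \<beta>' = Oct (\<alpha> + \<alpha>') (v + v') (w + w') (\<beta> + \<beta>')"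

fun uminus_split_octonion where
  "- Oct \<alpha> v w \<beta> = Oct (- \<alpha>) (- v) (- w) (- \<beta>)"

definition "x - y = x + (- y)" for x y :: "'a split_octonion"

instance
proof
  fix a b c :: "'a split_octonion"
  show "a + b + c = a + (b + c)" by (cases a; cases b; cases c) (simp add: add.assoc)
  show "a + b = b + a" by (cases a; cases b) (simp add: add.commute)
  show "0 + a = a" by (cases a) (simp add: zero_split_octonion_def)
  show "- a + a = 0" by (cases a) (simp add: zero_split_octonion_def)
  show "a - b = a + - b" by (simp add: minus_split_octonion_def)
qed

end

instantiation split_octonion :: (field) "{times, one}"
begin

fun times_split_octonion where
  "Oct \<alpha> v w \<beta> * Oct \<alpha>' v' w' \<beta>' =
     Oct (\<alpha> * \<alpha>' - scalar_product v w')
         (\<alpha> *s v' + \<beta>' *s v + wedge w w')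
         (\<beta> *s w' + \<alpha>' *s w + wedge v v')
         (\<beta> * \<beta>' - scalar_product w v')"

definition "1 = Oct 1 0 0 1"

instance ..

end

fun oct_scale :: "'a::field \<Rightarrow> 'a split_octonion \<Rightarrow> 'a split_octonion" where
  "oct_scale c (Oct \<alpha> v w \<beta>) = Oct (c * \<alpha>) (c *s v) (c *s w) (c * \<beta>)"

lemma oct_vector_space: "vector_space (oct_scale :: 'a::field \<Rightarrow> _)"
proof
  fix a b :: 'a and x y :: "'a split_octonion"
  show "oct_scale a (x + y) = oct_scale a x + oct_scale a y"
    by (cases x; cases y) (simp add: distrib_left vec.scale_right_distrib)
  show "oct_scale (a + b) x = oct_scale a x + oct_scale b x"
    by (cases x) (simp add: distrib_right vec.scale_left_distrib)
  show "oct_scale a (oct_scale b x) = oct_scale (a * b) x"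
    by (cases x) (simp add: mult.assoc)
  show "oct_scale 1 x = x"
    by (cases x) simp
qed

lemma oct_one_mult: "1 * x = x" "x * 1 = x" for x :: "'a::field split_octonion"
  by (cases x; simp add: one_split_octonion_def scalar_product_def wedge_def vec_eq_iff forall_3)+

definition diagonal_subalgebra :: "'a::field split_octonion set" where
  "diagonal_subalgebra = {Oct \<alpha> 0 0 \<beta> | \<alpha> \<beta>. True}"


section \<open>Automorphisms\<close>

definition oct_automorphism :: "('a::field split_octonion \<Rightarrow> 'a split_octonion) \<Rightarrow> bool" where
  "oct_automorphism f \<longleftrightarrow>
     Vector_Spaces.linear oct_scale oct_scale f \<and> bij f \<and>
     f 1 = 1 \<and> (\<forall>x y. f (x * y) = f x * f y)"

definition oct_Aut :: "('a::field split_octonion \<Rightarrow> 'a split_octonion) monoid" where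
  "oct_Aut = \<lparr>carrier = {f. oct_automorphism f}, mult = (\<circ>), one = id\<rparr>"

lemma oct_linear_iff:
  "Vector_Spaces.linear oct_scale oct_scale f \<longleftrightarrow>
     (\<forall>x y. f (x + y) = f x + f y) \<and> (\<forall>c x. f (oct_scale c x) = oct_scale c (f x))"
  for f :: "'a::field split_octonion \<Rightarrow> 'a split_octonion"
  using oct_vector_space by (auto simp: Vector_Spaces.linear_iff)

lemma oct_automorphism_inv:
  assumes "oct_automorphism f"
  shows "oct_automorphism (inv_into UNIV f)"
proof -
  have b: "bij f" using assms by (simp add: oct_automorphism_def)
  then have 1: "f (inv_into UNIV f x) = x" and 2: "inv_into UNIV f (f x) = x" for x
    by (simp_all add: bij_is_surj surj_f_inv_f bij_is_inj)
  have 3: "inv_into UNIV f y = x" if "f x = y" for x y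
    using that 2 by auto
  show ?thesis
    using assms b unfolding oct_automorphism_def oct_linear_iff
    by (auto intro!: 3 simp: 1 bij_imp_bij_inv)
qed

lemma oct_Aut_group: "group (oct_Aut :: ('a::field split_octonion \<Rightarrow> _) monoid)"
proof (rule groupI)
  fix f :: "'a split_octonion \<Rightarrow> 'a split_octonion"
  assume f: "f \<in> carrier oct_Aut"
  then have "oct_automorphism (inv_into UNIV f)" "inv_into UNIV f \<circ> f = id"
    using oct_automorphism_inv by (auto simp: oct_Aut_def oct_automorphism_def bij_is_inj)
  then show "\<exists>g\<in>carrier oct_Aut. g \<otimes>\<^bsub>oct_Aut\<^esub> f = \<one>\<^bsub>oct_Aut\<^esub>"
    by (auto simp: oct_Aut_def)
qed (auto simp: oct_Aut_def oct_automorphism_def oct_linear_iff bij_comp comp_assoc)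

definition conjugate_in :: "('g, 'm) monoid_scheme \<Rightarrow> 'g \<Rightarrow> 'g \<Rightarrow> bool" where
  "conjugate_in G x y \<longleftrightarrow> (\<exists>g\<in>carrier G. g \<otimes>\<^bsub>G\<^esub> x \<otimes>\<^bsub>G\<^esub> inv\<^bsub>G\<^esub> g = y)"

definition real_element :: "('g, 'm) monoid_scheme \<Rightarrow> 'g \<Rightarrow> bool" where
  "real_element G x \<longleftrightarrow> conjugate_in G x (inv\<^bsub>G\<^esub> x)"

fun SL3_aut :: "'a::field ^ 3 ^ 3 \<Rightarrow> 'a split_octonion \<Rightarrow> 'a split_octonion" where
  "SL3_aut B (Oct \<alpha> v w \<beta>) = Oct \<alpha> (B *v v) (transpose (matrix_inv B) *v w) \<beta>"

lemma SL3_aut_in_oct_Aut: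
  fixes B :: "'a::field ^ 3 ^ 3"
  assumes "det B = 1"
  shows "SL3_aut B \<in> carrier oct_Aut"
proof -
  define N where "N = matrix_inv B"
  have inv: "invertible B" using assms by (simp add: invertible_det_nz)
  have "B ** N = mat 1 \<and> N ** B = mat 1"
    unfolding N_def matrix_inv_def by (rule someI_ex) (use inv in \<open>simp add: invertible_def\<close>)
  then have BN: "B ** N = mat 1" and NB: "N ** B = mat 1"
    by auto
  have TB: "transpose N ** transpose B = mat 1" and BT: "transpose B ** transpose N = mat 1"
    using BN NB by (metis matrix_transpose_mul transpose_mat)+
  have dN: "det (transpose N) = 1"
    using BN assms by (metis det_I det_mul det_transpose mult_1)
  have w1: "wedge (B *v u) (B *v v) = transpose N *v wedge u v" for u v
    by (rule wedge_matrix[OF BN assms])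
  have w2: "wedge (transpose N *v u) (transpose N *v v) = B *v wedge u v" for u v
    using wedge_matrix[OF TB dN] by simp
  have s1: "scalar_product (B *v v) (transpose N *v w) = scalar_product v w" for v w
    using scalar_product_transpose[of "transpose B"]
    by (simp add: matrix_vector_mul_assoc BT del: transpose_matrix_vector)
  have s2: "scalar_product (transpose N *v w) (B *v v) = scalar_product w v" for v w
    by (simp add: scalar_product_transpose matrix_vector_mul_assoc NB del: transpose_matrix_vector)
  note lin = matrix_vector_right_distrib vector_scalar_commute
  have "bij (SL3_aut B)"
  proof (rule o_bij)
    let ?g = "\<lambda>x. case x of Oct \<alpha> v w \<beta> \<Rightarrow> Oct \<alpha> (N *v v) (transpose B *v w) \<beta>"
    show "?g \<circ> SL3_aut B = id"
      by (rule ext, rename_tac x, case_tac x)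
        (simp add: N_def[symmetric] matrix_vector_mul_assoc NB BT del: transpose_matrix_vector)
    show "SL3_aut B \<circ> ?g = id"
      by (rule ext, rename_tac x, case_tac x)
        (simp add: N_def[symmetric] matrix_vector_mul_assoc BN TB del: transpose_matrix_vector)
  qed
  moreover have "SL3_aut B (x + y) = SL3_aut B x + SL3_aut B y" for x y
    by (cases x; cases y) (simp add: lin)
  moreover have "SL3_aut B (oct_scale c x) = oct_scale c (SL3_aut B x)" for c x
    by (cases x) (simp add: lin)
  moreover have "SL3_aut B (x * y) = SL3_aut B x * SL3_aut B y" for x y
    by (cases x; cases y) (simp add: N_def[symmetric] lin w1 w2 s1 s2 del: transpose_matrix_vector)
  moreover have "SL3_aut B 1 = 1"
    by (simp add: one_split_octonion_def)
  ultimately show ?thesis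
    by (simp add: oct_Aut_def oct_automorphism_def oct_linear_iff)
qed

lemma SL3_aut_fixes_diagonal: "x \<in> diagonal_subalgebra \<Longrightarrow> SL3_aut B x = x"
  by (auto simp: diagonal_subalgebra_def)


section \<open>Roots of unity and diagonal matrices\<close>

definition primitive_root_of_unity :: "nat \<Rightarrow> 'a::field \<Rightarrow> bool" where
  "primitive_root_of_unity n x \<longleftrightarrow> n > 0 \<and> x ^ n = 1 \<and> (\<forall>m. 0 < m \<and> m < n \<longrightarrow> x ^ m \<noteq> 1)"

definition diag3 :: "'a::field \<Rightarrow> 'a \<Rightarrow> 'a \<Rightarrow> 'a ^ 3 ^ 3" where
  "diag3 a b c = vector [vector [a, 0, 0], vector [0, b, 0], vector [0, 0, c]]"

end

theory Submission
  imports Defs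
begin

text \<open>An automorphism \<open>g\<close> with \<open>g t g\<^sup>-\<^sup>1 = t\<^sup>-\<^sup>1\<close> preserves the fixed space \<open>L\<close> of \<open>t\<close>, so it fixes or
  swaps the two primitive idempotents of \<open>L\<close>.  It cannot fix them, since \<open>\<omega>\<close> is the only eigenvalue
  of \<open>B\<close> and \<open>\<omega>\<^sup>2 \<noteq> 1\<close>.  Hence it swaps the two off-diagonal spaces through a matrix \<open>Q\<close> with
  \<open>Q B = B\<^sup>T Q\<close>; since \<open>g\<close> is multiplicative, \<open>det Q = 1\<close>.  Solving the linear equations for \<open>Q\<close>
  gives \<open>det Q = b c\<^sup>3\<close> for an entry \<open>c\<close> of \<open>Q\<close>, so \<open>b\<close> is a cube and \<open>X\<^sup>3 - b\<^sup>2\<close> has a root.\<close>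

lemma vec3_eq_iff: "x = y \<longleftrightarrow> x $ 1 = y $ 1 \<and> x $ 2 = y $ 2 \<and> x $ 3 = y $ 3"
  for x y :: "'a ^ 3"
  by (simp add: vec_eq_iff forall_3)

lemma matrix3_mult_vec:
  fixes M :: "'a::semiring_1 ^ 3 ^ 3"
  shows "(M *v v) $ i = M $ i $ 1 * v $ 1 + M $ i $ 2 * v $ 2 + M $ i $ 3 * v $ 3"
  by (simp add: matrix_vector_mult_def sum_3)

lemma wedge_zero [simp]: "wedge 0 v = 0" "wedge v 0 = 0"
  by (simp_all add: wedge_def vec3_eq_iff)

lemma scalar_product_zero [simp]:
  "scalar_product 0 v = 0" "scalar_product v 0 = 0" for v :: "'a::field ^ 'n"
  by (simp_all add: scalar_product_def)

lemma matrix_inv_mult: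
  fixes M :: "'a::field ^ 'n ^ 'n"
  assumes "invertible M"
  shows "M ** matrix_inv M = mat 1" "matrix_inv M ** M = mat 1"
proof -
  have "M ** matrix_inv M = mat 1 \<and> matrix_inv M ** M = mat 1"
    unfolding matrix_inv_def by (rule someI_ex) (use assms in \<open>simp add: invertible_def\<close>)
  then show "M ** matrix_inv M = mat 1" "matrix_inv M ** M = mat 1" by auto
qed

text \<open>The inverse transpose is the inverse of the transpose. This trades
  \<open>matrix_inv\<close>, which is given only by a choice, for an equation in the explicit
  entries of \<open>M\<close>.\<close>

lemma transpose_inv_mult_vec_eq_iff:
  fixes M :: "'a::field ^ 'n ^ 'n"
  assumes "invertible M"
  shows "transpose (matrix_inv M) *v w = u \<longleftrightarrow> w = transpose M *v u"
proof -
  have "transpose M ** transpose (matrix_inv M) = mat 1"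
       "transpose (matrix_inv M) ** transpose M = mat 1"
    using matrix_inv_mult[OF assms] by (metis matrix_transpose_mul transpose_mat)+
  then show ?thesis
    by (metis matrix_vector_mul_assoc matrix_vector_mul_lid)
qed

lemma diagonal_idempotent_cases:
  assumes "x \<in> diagonal_subalgebra" "x * x = x" "x \<noteq> 0" "x \<noteq> 1"
  shows "x = Oct 1 0 0 0 \<or> x = Oct 0 0 0 1"
  using assms
  by (auto simp: diagonal_subalgebra_def zero_split_octonion_def one_split_octonion_def)

text \<open>Multiplication by this idempotent keeps \<alpha> and v from the left, but \<alpha> and w
  from the right. The off-diagonal space is thus cut out by products alone, so an automorphism
  carries it along with the idempotent.\<close>

lemma peirce_upper_iff:
  "Oct 1 0 0 0 * x = x \<and> x * Oct 1 0 0 0 = 0 \<longleftrightarrow> (\<exists>v. x = Oct 0 v 0 0)"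
  by (cases x) (auto simp: zero_split_octonion_def)

lemma peirce_lower_iff:
  "Oct 0 0 0 1 * x = x \<and> x * Oct 0 0 0 1 = 0 \<longleftrightarrow> (\<exists>w. x = Oct 0 0 w 0)"
  by (cases x) (auto simp: zero_split_octonion_def)

lemma fixed_SL3_aut_imp_diagonal:
  assumes "invertible B"
    and "\<And>v. B *v v = v \<Longrightarrow> v = 0" and "\<And>w. transpose B *v w = w \<Longrightarrow> w = 0"
    and "SL3_aut B x = x"
  shows "x \<in> diagonal_subalgebra"
proof (cases x)
  case (Oct \<alpha> v w \<beta>)
  with assms(4) have "B *v v = v" "transpose (matrix_inv B) *v w = w" by simp_all
  then have "v = 0" "w = 0"
    using assms(2,3) transpose_inv_mult_vec_eq_iff[OF assms(1), of w w] by metis+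
  then show ?thesis by (simp add: Oct diagonal_subalgebra_def)
qed

text \<open>The relation g t g^-1 = t^-1 is put in the form t g t = g, free of group inverses, so
  that it can be evaluated on octonions.\<close>

lemma real_elementE:
  assumes "real_element oct_Aut t" and "t \<in> carrier oct_Aut"
  obtains g where "oct_automorphism g" and "\<And>x. t (g (t x)) = g x"
proof -
  interpret group "oct_Aut :: ('a split_octonion \<Rightarrow> _) monoid" by (rule oct_Aut_group)
  obtain g where g: "g \<in> carrier oct_Aut"
    and eq: "g \<otimes>\<^bsub>oct_Aut\<^esub> t \<otimes>\<^bsub>oct_Aut\<^esub> inv\<^bsub>oct_Aut\<^esub> g = inv\<^bsub>oct_Aut\<^esub> t"
    using assms(1) by (auto simp: real_element_def conjugate_in_def)
  from eq have "g \<otimes>\<^bsub>oct_Aut\<^esub> t = inv\<^bsub>oct_Aut\<^esub> t \<otimes>\<^bsub>oct_Aut\<^esub> g"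
    using g assms(2) by (metis inv_closed inv_solve_right m_closed)
  then have "t \<otimes>\<^bsub>oct_Aut\<^esub> (g \<otimes>\<^bsub>oct_Aut\<^esub> t) = g"
    using g assms(2) by (metis inv_solve_left m_closed)
  then have "t (g (t x)) = g x" for x
    by (simp add: oct_Aut_def fun_eq_iff)
  then show thesis
    using that g by (simp add: oct_Aut_def)
qed

text \<open>Since t g t = g, the image of the idempotent is fixed by t, hence a nontrivial
  idempotent of the diagonal. If it were unchanged, g would map the eigenvector u to a nonzero v
  with \<omega> B v = v, which \<open>no_eigen\<close> excludes.\<close>

lemma reversing_automorphism_lower:
  fixes B :: "'a::field ^ 3 ^ 3" and \<omega> :: 'a
  assumes aut: "oct_automorphism g"
    and rev: "\<And>x. SL3_aut B (g (SL3_aut B x)) = g x"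
    and inv: "invertible B"
    and fixB: "\<And>v. B *v v = v \<Longrightarrow> v = 0" and fixT: "\<And>w. transpose B *v w = w \<Longrightarrow> w = 0"
    and eigen: "B *v u = \<omega> *s u" "u \<noteq> 0"
    and no_eigen: "\<And>v. \<omega> *s (B *v v) = v \<Longrightarrow> v = 0"
  shows "g (Oct 1 0 0 0) = Oct 0 0 0 1"
proof -
  have g_mult: "g (x * y) = g x * g y" and g_one: "g 1 = 1"
    and g_scale: "g (oct_scale c x) = oct_scale c (g x)"
    and g_add: "g (x + y) = g x + g y" and g_inj: "g x = g y \<longleftrightarrow> x = y" for x y c
    using aut by (auto simp: oct_automorphism_def oct_linear_iff bij_def inj_eq)
  have g_zero: "g 0 = 0" using g_add[of 0 0] by simp
  let ?e = "Oct 1 0 0 0 :: 'a split_octonion"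
  have "SL3_aut B (g ?e) = g ?e" using rev[of ?e] by simp
  then have "g ?e \<in> diagonal_subalgebra"
    using fixed_SL3_aut_imp_diagonal[OF inv fixB fixT] by blast
  moreover have "g ?e * g ?e = g ?e" using g_mult[of ?e ?e] by simp
  moreover have "g ?e \<noteq> 0" "g ?e \<noteq> 1"
    using g_inj[of ?e 0] g_inj[of ?e 1] g_zero g_one
    by (auto simp: zero_split_octonion_def one_split_octonion_def)
  moreover have "g ?e \<noteq> ?e"
  proof
    assume e: "g ?e = ?e"
    have "?e * Oct 0 u 0 0 = Oct 0 u 0 0" "Oct 0 u 0 0 * ?e = 0"
      using peirce_upper_iff[of "Oct 0 u 0 0"] by blast+
    then have "?e * g (Oct 0 u 0 0) = g (Oct 0 u 0 0)" "g (Oct 0 u 0 0) * ?e = 0"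
      using g_mult e g_zero by metis+
    then obtain v where v: "g (Oct 0 u 0 0) = Oct 0 v 0 0"
      using peirce_upper_iff by blast
    have "SL3_aut B (Oct 0 u 0 0) = oct_scale \<omega> (Oct 0 u 0 0)"
      using eigen(1) by simp
    then have "SL3_aut B (oct_scale \<omega> (Oct 0 v 0 0)) = Oct 0 v 0 0"
      using rev[of "Oct 0 u 0 0"] v g_scale by metis
    then have "\<omega> *s (B *v v) = v" by (simp add: vector_scalar_commute)
    then have "g (Oct 0 u 0 0) = g 0"
      using no_eigen v g_zero by (simp add: zero_split_octonion_def)
    then show False using g_inj eigen(2) by (simp add: zero_split_octonion_def)
  qed
  ultimately show ?thesis using diagonal_idempotent_cases by blast
qed

text \<open>Cross product and pairing are both entries of octonion products, so g respects them. The
  determinant is a triple product built from the two, hence that of the images of the basis equals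
  that of the basis itself.\<close>

lemma swapping_automorphism_matrix:
  fixes g :: "'a::field split_octonion \<Rightarrow> 'a split_octonion"
  assumes aut: "oct_automorphism g" and swap: "g (Oct 1 0 0 0) = Oct 0 0 0 1"
  obtains Q where "\<And>v. g (Oct 0 v 0 0) = Oct 0 0 (Q *v v) 0" "det Q = 1"
proof -
  have g_mult: "g (x * y) = g x * g y" and g_one: "g 1 = 1"
    and g_scale: "g (oct_scale c x) = oct_scale c (g x)"
    and g_add: "g (x + y) = g x + g y" for x y c
    using aut by (auto simp: oct_automorphism_def oct_linear_iff)
  have g_zero: "g 0 = 0" using g_add[of 0 0] by simp
  have "Oct 1 0 0 0 + Oct 0 0 0 1 = (1 :: 'a split_octonion)"
    by (simp add: one_split_octonion_def)
  then have "Oct 0 0 0 1 + g (Oct 0 0 0 1) = Oct 0 0 0 1 + Oct 1 0 0 0"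
    using g_add[of "Oct 1 0 0 0" "Oct 0 0 0 1"] g_one swap by (simp add: add.commute)
  then have swap': "g (Oct 0 0 0 1) = Oct 1 0 0 0"
    using add_left_cancel by blast
  have "\<exists>w. g (Oct 0 v 0 0) = Oct 0 0 w 0" for v
  proof -
    have "Oct 1 0 0 0 * Oct 0 v 0 0 = Oct 0 v 0 0" "Oct 0 v 0 0 * Oct 1 0 0 0 = 0"
      using peirce_upper_iff[of "Oct 0 v 0 0"] by blast+
    then show ?thesis
      using g_mult swap g_zero peirce_lower_iff[of "g (Oct 0 v 0 0)"] by metis
  qed
  then obtain q where q: "\<And>v. g (Oct 0 v 0 0) = Oct 0 0 (q v) 0" by metis
  have "\<exists>v. g (Oct 0 0 w 0) = Oct 0 v 0 0" for w
  proof -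
    have "Oct 0 0 0 1 * Oct 0 0 w 0 = Oct 0 0 w 0" "Oct 0 0 w 0 * Oct 0 0 0 1 = 0"
      using peirce_lower_iff[of "Oct 0 0 w 0"] by blast+
    then show ?thesis
      using g_mult swap' g_zero peirce_upper_iff[of "g (Oct 0 0 w 0)"] by metis
  qed
  then obtain p where p: "\<And>w. g (Oct 0 0 w 0) = Oct 0 (p w) 0 0" by metis
  have q_add: "q (v + v') = q v + q v'" for v v'
    using g_add[of "Oct 0 v 0 0" "Oct 0 v' 0 0"] by (simp add: q)
  have q_scale: "q (c *s v) = c *s q v" for c v
    using g_scale[of c "Oct 0 v 0 0"] by (simp add: q)
  have lin: "Vector_Spaces.linear (*s) (*s) q"
    using vec.vector_space_axioms by (simp add: Vector_Spaces.linear_iff q_add q_scale)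
  have mat: "matrix q *v v = q v" for v
    using matrix_works[OF lin] by simp
  \<comment> \<open>Two upper elements multiply to a lower one and vice versa, so p enters on the
    right.\<close>
  have wedge_q: "wedge (q v) (q v') = p (wedge v v')" for v v'
    using g_mult[of "Oct 0 v 0 0" "Oct 0 v' 0 0"] by (simp add: p q)
  have dual: "scalar_product (q v) (p w) = scalar_product v w" for v w
  proof -
    have "Oct 0 v 0 0 * Oct 0 0 w 0 = oct_scale (- scalar_product v w) (Oct 1 0 0 0)"
      by simp
    then have "g (Oct 0 v 0 0) * g (Oct 0 0 w 0) = oct_scale (- scalar_product v w) (Oct 0 0 0 1)"
      using g_mult g_scale swap by metis
    then show ?thesis by (simp add: p q)
  qed
  let ?u = "axis 1 1 :: 'a ^ 3" and ?v = "axis 2 1 :: 'a ^ 3" and ?w = "axis 3 1 :: 'a ^ 3"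
  have "det (matrix q) = scalar_product (q ?w) (wedge (q ?u) (q ?v))"
    by (simp add: det_3 matrix_def scalar_product_def wedge_def sum_3 algebra_simps)
  also have "\<dots> = scalar_product ?w (wedge ?u ?v)"
    by (simp add: wedge_q dual)
  also have "\<dots> = 1"
    by (simp add: scalar_product_def wedge_def sum_3 axis_def)
  finally show thesis using that[of "matrix q"] by (simp add: mat q)
qed

lemma det_symmetrizer:
  fixes Q B :: "'a::field ^ 3 ^ 3"
  assumes "B = vector [vector [\<omega>, - b, 0], vector [0, \<omega>, 1], vector [0, 0, \<omega>]]"
    and "b \<noteq> 0" and "Q ** B = transpose B ** Q"
  shows "det Q = b * (Q $ 1 $ 3) ^ 3"
proof -
  have "(Q ** B) $ i $ j = (transpose B ** Q) $ i $ j" for i j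
    using assms(3) by simp
  then have eq: "(\<Sum>k\<in>UNIV. Q $ i $ k * B $ k $ j) = (\<Sum>k\<in>UNIV. B $ k $ i * Q $ k $ j)" for i j
    by (simp add: matrix_matrix_mult_def transpose_def)
  note eqs = eq[of 1 2] eq[of 1 3] eq[of 2 2] eq[of 2 3] eq[of 3 1] eq[of 3 2]
  have 1: "Q $ 1 $ 1 = 0" "Q $ 1 $ 2 = 0" "Q $ 2 $ 1 = 0"
    using eqs assms(2) by (auto simp: assms(1) sum_3 algebra_simps)
  have 2: "Q $ 2 $ 2 = - b * Q $ 1 $ 3" "Q $ 2 $ 2 = - b * Q $ 3 $ 1"
    using eqs by (auto simp: assms(1) sum_3 algebra_simps eq_neg_iff_add_eq_0)
  then have "Q $ 3 $ 1 = Q $ 1 $ 3"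
    using assms(2) by simp
  with 1 2 show ?thesis
    by (simp add: det_3 power3_eq_cube)
qed

text \<open>A root splits off a linear factor with a quadratic cofactor, and neither is a
  unit.\<close>

lemma irreducible_cubic_no_root:
  fixes a r :: "'a::field"
  assumes "irreducible (monom 1 3 - [:a:])"
  shows "r ^ 3 \<noteq> a"
proof
  assume "r ^ 3 = a"
  then have "poly (monom 1 3 - [:a:]) r = 0"
    by (simp add: poly_monom)
  then obtain p where p: "monom 1 3 - [:a:] = [:- r, 1:] * p"
    unfolding poly_eq_0_iff_dvd by (rule dvdE)
  have deg: "degree (monom 1 3 - [:a:]) = 3"
    by (simp add: monom_altdef numeral_3_eq_3)
  then have "p \<noteq> 0" using p by auto
  then have "degree ([:- r, 1:] * p) = degree [:- r, 1:] + degree p"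
    by (intro degree_mult_eq) auto
  then have "degree [:- r, 1:] + degree p = 3"
    unfolding p[symmetric] deg by (rule sym)
  then have "degree p = 2" by simp
  show False
    using irreducibleD[OF assms p] \<open>p \<noteq> 0\<close> \<open>degree p = 2\<close>
      is_unit_iff_degree[of p] is_unit_iff_degree[of "[:- r, 1:]"] by simp
qed

theorem theorem6p11:
  fixes \<omega> b :: "'k::{field, finite}"
    and A D B :: "'k ^ 3 ^ 3"
    and t :: "'k split_octonion \<Rightarrow> 'k split_octonion"
  assumes "CHAR('k) \<noteq> 2" and "CHAR('k) \<noteq> 3"
    and "primitive_root_of_unity 3 \<omega>"
    and "A = vector [vector [\<omega>, -1, 0],
                     vector [0, \<omega>, 1],
                     vector [0, 0, \<omega>]]"
    and "irreducible (monom 1 3 - [:b ^ 2:])"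
    and "D = diag3 b 1 1"
    and "B = D ** A ** matrix_inv D"
    and "t = SL3_aut B"
  shows "\<not> real_element oct_Aut t"
proof
  assume real: "real_element oct_Aut t"
  have \<omega>: "\<omega> ^ 3 = 1" "\<omega> \<noteq> 1" "\<omega> ^ 2 \<noteq> 1"
    using assms(3) unfolding primitive_root_of_unity_def by (auto dest: spec[of _ 1] spec[of _ 2])
  have b: "b \<noteq> 0"
    using irreducible_cubic_no_root[OF assms(5), of 0] by auto
  have "det D = b"
    by (simp add: assms(6) diag3_def det_3)
  then have D: "invertible D" using b by (simp add: invertible_det_nz)
  let ?B = "vector [vector [\<omega>, - b, 0], vector [0, \<omega>, 1], vector [0, 0, \<omega>]] :: 'k ^ 3 ^ 3"
  \<comment> \<open>Comparing the two products identifies \<open>B\<close> without computing the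
    inverse of \<open>D\<close>.\<close>
  have "D ** A = ?B ** D"
    by (simp add: assms(4,6) diag3_def vec3_eq_iff matrix_matrix_mult_def sum_3)
  then have B: "B = ?B"
    using assms(7) matrix_inv_mult[OF D] by (metis matrix_mul_assoc matrix_mul_rid)
  have "det B = 1"
    using \<omega> by (simp add: B det_3 power3_eq_cube)
  then have inv: "invertible B" and t: "t \<in> carrier oct_Aut"
    using SL3_aut_in_oct_Aut[of B] assms(8) by (simp_all add: invertible_det_nz)
  obtain g where g: "oct_automorphism g" and rev: "\<And>x. t (g (t x)) = g x"
    using real_elementE[OF real t] by blast
  have "g (Oct 1 0 0 0) = Oct 0 0 0 1"
  proof (rule reversing_automorphism_lower[OF g])
    show "SL3_aut B (g (SL3_aut B x)) = g x" for x
      using rev assms(8) by simp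
    show "v = 0" if "B *v v = v" for v
    proof -
      have "\<omega> * v $ 1 - b * v $ 2 = v $ 1" "\<omega> * v $ 2 + v $ 3 = v $ 2" "\<omega> * v $ 3 = v $ 3"
        using that by (auto simp: vec3_eq_iff matrix3_mult_vec B)
      then show ?thesis using \<omega>(2) by (auto simp: vec3_eq_iff)
    qed
    show "w = 0" if "transpose B *v w = w" for w
    proof -
      have "\<omega> * w $ 1 = w $ 1" "\<omega> * w $ 2 - b * w $ 1 = w $ 2" "\<omega> * w $ 3 + w $ 2 = w $ 3"
        using that
        by (auto simp: vec3_eq_iff matrix3_mult_vec B transpose_def algebra_simps
            simp del: transpose_matrix_vector)
      then show ?thesis using \<omega>(2) by (auto simp: vec3_eq_iff)
    qed
    show "B *v axis 1 1 = \<omega> *s axis 1 1"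
      by (simp add: vec3_eq_iff matrix3_mult_vec B axis_def)
    \<comment> \<open>The matrix \<omega> B is upper triangular with diagonal entries \<omega>^2,
      different from 1, so back substitution from the last coordinate gives zero.\<close>
    show "v = 0" if "\<omega> *s (B *v v) = v" for v
    proof -
      have z: "x = 0" if "\<omega> * (\<omega> * x) = x" for x
        using that \<omega>(3) by (simp add: power2_eq_square flip: mult.assoc)
      have eqs: "\<omega> * (\<omega> * v $ 1 - b * v $ 2) = v $ 1" "\<omega> * (\<omega> * v $ 2 + v $ 3) = v $ 2"
        "\<omega> * (\<omega> * v $ 3) = v $ 3"
        using that by (auto simp: vec3_eq_iff matrix3_mult_vec B)
      have "v $ 3 = 0" using eqs(3) by (rule z)
      moreover from this have "v $ 2 = 0"
        using z[of "v $ 2"] eqs(2) by simp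
      moreover from this have "v $ 1 = 0"
        using z[of "v $ 1"] eqs(1) by simp
      ultimately show ?thesis by (simp add: vec3_eq_iff)
    qed
  qed (use inv in auto)
  then obtain Q where Q: "\<And>v. g (Oct 0 v 0 0) = Oct 0 0 (Q *v v) 0" and "det Q = 1"
    using swapping_automorphism_matrix[OF g] by blast
  have "Q ** B = transpose B ** Q"
  proof (rule matrix_eq[THEN iffD2], rule allI)
    fix v
    \<comment> \<open>This is t g t = g on an upper element: t acts by \<open>B\<close> before g
      moves it to the lower space, and by the inverse transpose afterwards.\<close>
    have "transpose (matrix_inv B) *v (Q *v (B *v v)) = Q *v v"
      using rev[of "Oct 0 v 0 0"] assms(8) by (simp add: Q del: transpose_matrix_vector)
    then show "(Q ** B) *v v = (transpose B ** Q) *v v"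
      using transpose_inv_mult_vec_eq_iff[OF inv] by (metis matrix_vector_mul_assoc)
  qed
  then have "b * (Q $ 1 $ 3) ^ 3 = 1"
    using det_symmetrizer[OF B b] \<open>det Q = 1\<close> by simp
  then have "b = inverse (Q $ 1 $ 3) ^ 3"
    by (metis inverse_unique power_inverse mult.commute)
  \<comment> \<open>As b is the cube of this inverse, b^2 is the cube of its square, a root of the
    irreducible cubic.\<close>
  then have "(inverse (Q $ 1 $ 3) ^ 2) ^ 3 = b ^ 2"
    by (simp flip: power_mult)
  then show False using irreducible_cubic_no_root[OF assms(5)] by blast
qed

end
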